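(* Let $a<c<d<b$ be real numbers and let $T:[a,b]\to[a,b]$ be a map that is monotonic on each of the intervals $[a,c]$ and $[d,b]$ and satisfies $T([a,c])=T([d,b])=[a,b]$ and $T((c,d))\subset\{a,b\}$. Let $0<\lambda<1/2$, and let $\varphi:[a,b]\to[1/2,\,1-\lambda/2]$ be strictly monotonic with $|\varphi(c)-\varphi(d)|>\lambda$. Let $Q=[a,b]\times[0,1]$ and define $F:Q\to Q$ by $F(x,y)=\left(T(x),\ \varphi(x)+\lambda\left(y-\tfrac12\right)\right)$. Then the attractor $\Lambda:=\bigcap_{n=0}^{\infty}F^n(Q)$ has Hausdorff dimension $$\dim_H(\Lambda)=1+\frac{\log 2}{-\log\lambda}.$$
   Context: $\dim_H$ denotes the Hausdorff dimension of a subset of $\mathbb{R}^2$ with the Euclidean metric. $F^n$ denotes the $n$-fold composition of $F$ with itself, with $F^0=\mathrm{id}$. *)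

theory Defs
  imports "HOL-Analysis.Analysis"
begin

(* The term |U|^s of a Hausdorff sum, with the conventions 0^0 = 1 for nonempty U and
   |{}|^s = 0 also for s = 0; the case distinction is needed because 0 powr 0 = 0.
   Only meaningful for bounded U, since diameter is a real supremum. *)
definition diam_powr :: "'a::metric_space set \<Rightarrow> real \<Rightarrow> ennreal" where
  "diam_powr U s = (if U = {} then 0 else if s = 0 then 1 else ennreal (diameter U powr s))"

definition delta_covers :: "real \<Rightarrow> 'a::metric_space set \<Rightarrow> (nat \<Rightarrow> 'a set) set" where
  "delta_covers \<delta> E = {U. E \<subseteq> (\<Union>i. U i) \<and> (\<forall>i. bounded (U i) \<and> diameter (U i) \<le> \<delta>)}"

definition hausdorff_premeasure :: "real \<Rightarrow> real \<Rightarrow> 'a::metric_space set \<Rightarrow> ennreal" where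
  "hausdorff_premeasure s \<delta> E = (INF U\<in>delta_covers \<delta> E. \<Sum>i. diam_powr (U i) s)"

(* Outer measure, defined on arbitrary sets. *)
definition hausdorff_measure :: "real \<Rightarrow> 'a::metric_space set \<Rightarrow> ennreal" where
  "hausdorff_measure s E = (SUP \<delta>\<in>{0<..}. hausdorff_premeasure s \<delta> E)"

definition hausdorff_dim :: "'a::metric_space set \<Rightarrow> ereal" where
  "hausdorff_dim E = Inf {ereal s | s. 0 \<le> s \<and> hausdorff_measure s E = 0}"

end

theory Submission
  imports Defs
begin

text \<open>Upper bound: off countably many vertical lines, \<open>F\<^sup>n(Q)\<close> lies within \<open>lam\<^sup>n\<close> of the graphs of
  \<open>2\<^sup>n\<close> functions, one for each word of inverse branches of \<open>T\<close>. Their variation is bounded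
  uniformly in \<open>n\<close>, so \<open>O((2/lam)\<^sup>n)\<close> sets of diameter \<open>O(lam\<^sup>n)\<close> suffice.

  Lower bound: over each \<open>x\<close> the attractor contains a Cantor set parametrised by \<open>{0..<1}\<close> through
  binary itineraries. The gap condition on \<open>\<phi>\<close> makes the inverse of this parametrisation Hoelder
  with exponent \<open>s = ln 2 / (- ln lam)\<close>, so a set of diameter \<open>r\<close> captures at most
  \<open>O(r\<^sup>s)\<close> of each fibre and meets the fibres over a set of measure \<open>O(r)\<close>; integrating over \<open>x\<close>
  bounds the sum of all \<open>r * r\<^sup>s\<close> from below for every cover.\<close>

section \<open>Null sets of Hausdorff measure\<close>

lemma hausdorff_measure_eq_0_iff:
  "hausdorff_measure t E = 0 \<longleftrightarrow> (\<forall>\<delta>>0. hausdorff_premeasure t \<delta> E = 0)"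
  unfolding hausdorff_measure_def bot_ennreal[symmetric] SUP_bot_conv by (meson greaterThan_iff)

lemma hausdorff_premeasure_eq_0I:
  assumes "\<And>e::real. e > 0 \<Longrightarrow> \<exists>U\<in>delta_covers \<delta> E. (\<Sum>i. diam_powr (U i) t) \<le> ennreal e"
  shows "hausdorff_premeasure t \<delta> E = 0"
proof -
  have "hausdorff_premeasure t \<delta> E \<le> 0"
  proof (rule ennreal_le_epsilon)
    fix e :: real assume "e > 0"
    then obtain U where "U \<in> delta_covers \<delta> E" "(\<Sum>i. diam_powr (U i) t) \<le> ennreal e"
      using assms by blast
    then show "hausdorff_premeasure t \<delta> E \<le> 0 + ennreal e"
      unfolding hausdorff_premeasure_def by (auto intro: INF_lower2)
  qed
  then show ?thesis by simp
qed

lemma hausdorff_premeasure_eq_0D: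
  assumes "hausdorff_premeasure t \<delta> E = 0" and "e > (0::ennreal)"
  obtains U where "U \<in> delta_covers \<delta> E" and "(\<Sum>i. diam_powr (U i) t) < e"
proof -
  have "(INF U\<in>delta_covers \<delta> E. \<Sum>i. diam_powr (U i) t) < e"
    using assms unfolding hausdorff_premeasure_def by simp
  then show thesis
    using that by (auto simp: INF_less_iff)
qed

lemma hausdorff_measure_mono:
  assumes "A \<subseteq> B"
  shows "hausdorff_measure t A \<le> hausdorff_measure t B"
proof -
  have "delta_covers \<delta> B \<subseteq> delta_covers \<delta> A" for \<delta>
    using assms unfolding delta_covers_def by auto
  then show ?thesis
    unfolding hausdorff_measure_def hausdorff_premeasure_def
    by (intro SUP_mono' INF_superset_mono) auto
qed

text \<open>The \<open>n\<close>-th set gets a cover of total weight at most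
  \<open>e / 2 ^ (n + 1)\<close>; the pairing bijection on the naturals merges all covers into a
  single sequence of weight at most \<open>e\<close>.\<close>

lemma hausdorff_measure_UN_eq_0:
  fixes E :: "nat \<Rightarrow> 'a::metric_space set"
  assumes "\<And>n. hausdorff_measure t (E n) = 0"
  shows "hausdorff_measure t (\<Union>n. E n) = 0"
  unfolding hausdorff_measure_eq_0_iff
proof (intro allI impI hausdorff_premeasure_eq_0I)
  fix \<delta> e :: real assume "\<delta> > 0" "e > 0"
  have "\<exists>U\<in>delta_covers \<delta> (E n). (\<Sum>i. diam_powr (U i) t) \<le> ennreal (e * (1/2)^Suc n)" for n
  proof -
    have "hausdorff_premeasure t \<delta> (E n) = 0"
      using assms \<open>\<delta> > 0\<close> by (auto simp: hausdorff_measure_eq_0_iff)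
    moreover have "0 < ennreal (e * (1/2)^Suc n)"
      using \<open>e > 0\<close> by simp
    ultimately show ?thesis
      by (rule hausdorff_premeasure_eq_0D) (auto intro: less_imp_le)
  qed
  then obtain U where U: "\<And>n. U n \<in> delta_covers \<delta> (E n)"
      and sumU: "\<And>n. (\<Sum>i. diam_powr (U n i) t) \<le> ennreal (e * (1/2)^Suc n)"
    by metis
  define V where "V k = (case prod_decode k of (n, i) \<Rightarrow> U n i)" for k
  have "(\<Union>n. E n) \<subseteq> (\<Union>k. V k)"
  proof
    fix x assume "x \<in> (\<Union>n. E n)"
    then obtain n i where "x \<in> U n i"
      using U unfolding delta_covers_def by blast
    then have "x \<in> V (prod_encode (n, i))"
      by (simp add: V_def)
    then show "x \<in> (\<Union>k. V k)" by blast
  qed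
  moreover have "bounded (V k) \<and> diameter (V k) \<le> \<delta>" for k
    using U unfolding V_def delta_covers_def by (auto split: prod.split)
  ultimately have "V \<in> delta_covers \<delta> (\<Union>n. E n)"
    by (simp add: delta_covers_def)
  moreover have "(\<Sum>k. diam_powr (V k) t) \<le> ennreal e"
  proof -
    have "(\<Sum>k. diam_powr (V k) t) = (\<Sum>k. (\<lambda>(n,i). diam_powr (U n i) t) (prod_decode k))"
      by (simp add: V_def split_def)
    also have "\<dots> = (\<Sum>n. \<Sum>i. diam_powr (U n i) t)"
      by (rule suminf_ennreal_2dimen) simp
    also have "\<dots> \<le> (\<Sum>n. ennreal (e * (1/2)^Suc n))"
      by (intro suminf_le sumU) auto
    also have "\<dots> = ennreal e"
    proof -
      have "(\<lambda>n. e * (1/2)^Suc n) sums (e * 1)"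
        by (intro sums_mult power_half_series)
      then show ?thesis
        using \<open>e > 0\<close> by (subst suminf_ennreal_eq) auto
    qed
    finally show ?thesis .
  qed
  ultimately show "\<exists>U\<in>delta_covers \<delta> (\<Union>n. E n). (\<Sum>i. diam_powr (U i) t) \<le> ennreal e"
    by blast
qed

lemma hausdorff_measure_Un_eq_0:
  assumes "hausdorff_measure t A = 0" "hausdorff_measure t B = 0"
  shows "hausdorff_measure t (A \<union> B) = 0"
proof -
  have "hausdorff_measure t (\<Union>n::nat. if n = 0 then A else B) = 0"
    using assms by (intro hausdorff_measure_UN_eq_0) auto
  moreover have "(\<Union>n::nat. if n = 0 then A else B) = A \<union> B"
    by (auto split: if_splits intro: exI[of _ 0] exI[of _ "1::nat"])
  ultimately show ?thesis by simp
qed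

text \<open>Box-counting criterion: one finite cover at a sufficiently late \<open>n\<close> meets
  both the size and the weight requirement. Since \<open>t > 0\<close>, every nonempty set has
  weight \<open>diameter powr t\<close> and not the value 1 of the zero exponent.\<close>

lemma hausdorff_measure_eq_0_of_finite_covers:
  fixes E :: "'a::metric_space set" and K r :: "nat \<Rightarrow> real"
  assumes t: "t > 0"
    and cov: "\<And>n. \<exists>\<U>. finite \<U> \<and> real (card \<U>) \<le> K n \<and> E \<subseteq> \<Union>\<U> \<and>
      (\<forall>U\<in>\<U>. bounded U \<and> diameter U \<le> r n)"
    and r: "r \<longlonglongrightarrow> 0" and lim: "(\<lambda>n. K n * r n powr t) \<longlonglongrightarrow> 0"
  shows "hausdorff_measure t E = 0"
  unfolding hausdorff_measure_eq_0_iff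
proof (intro allI impI hausdorff_premeasure_eq_0I)
  fix \<delta> e :: real assume "\<delta> > 0" "e > 0"
  have "eventually (\<lambda>n. r n < \<delta> \<and> K n * r n powr t < e) sequentially"
    by (intro eventually_conj order_tendstoD(2)[OF r] order_tendstoD(2)[OF lim] \<open>\<delta> > 0\<close> \<open>e > 0\<close>)
  then obtain n where n: "r n < \<delta>" "K n * r n powr t < e"
    using eventually_happens trivial_limit_sequentially by blast
  obtain \<U> where \<U>: "finite \<U>" "real (card \<U>) \<le> K n" "E \<subseteq> \<Union>\<U>"
      "\<And>U. U \<in> \<U> \<Longrightarrow> bounded U" "\<And>U. U \<in> \<U> \<Longrightarrow> diameter U \<le> r n"
    using cov[of n] by blast
  obtain g where g: "bij_betw g {..<card \<U>} \<U>"
    using \<U>(1) bij_betw_from_nat_into_finite by blast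
  \<comment> \<open>Padding by empty sets costs nothing, as
    \<open>diam_powr {} t = 0\<close>.\<close>
  define V where "V i = (if i < card \<U> then g i else {})" for i
  have g_in: "g i \<in> \<U>" if "i < card \<U>" for i
    using g that by (auto simp: bij_betw_def)
  have "E \<subseteq> (\<Union>i. V i)"
  proof
    fix x assume "x \<in> E"
    then obtain U where "x \<in> U" "U \<in> \<U>" using \<U>(3) by blast
    then obtain i where "i < card \<U>" "U = g i"
      using g by (auto simp: bij_betw_def)
    then show "x \<in> (\<Union>i. V i)"
      using \<open>x \<in> U\<close> by (auto simp: V_def intro!: exI[of _ i])
  qed
  moreover have "bounded (V i) \<and> diameter (V i) \<le> \<delta>" for i
    using \<U>(4,5)[OF g_in[of i]] n(1) \<open>\<delta> > 0\<close> by (cases "i < card \<U>") (auto simp: V_def)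
  ultimately have "V \<in> delta_covers \<delta> E"
    by (simp add: delta_covers_def)
  moreover have "(\<Sum>i. diam_powr (V i) t) \<le> ennreal e"
  proof -
    have "(\<Sum>i. diam_powr (V i) t) = (\<Sum>i<card \<U>. diam_powr (V i) t)"
      by (rule suminf_finite) (auto simp: V_def diam_powr_def)
    also have "\<dots> \<le> (\<Sum>i<card \<U>. ennreal (r n powr t))"
    proof (intro sum_mono)
      fix i assume "i \<in> {..<card \<U>}"
      then have "diameter (V i) \<le> r n" "0 \<le> diameter (V i)"
        using \<U>(4,5)[OF g_in[of i]] by (auto simp: V_def diameter_ge_0)
      then show "diam_powr (V i) t \<le> ennreal (r n powr t)"
        using t by (auto simp: diam_powr_def intro!: ennreal_leI powr_mono2)
    qed
    also have "\<dots> = ennreal (real (card \<U>) * r n powr t)"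
      by (simp add: ennreal_mult ennreal_of_nat_eq_real_of_nat)
    also have "\<dots> \<le> ennreal e"
      using \<U>(2) n(2) by (intro ennreal_leI) (smt (verit) mult_right_mono powr_ge_zero)
    finally show ?thesis .
  qed
  ultimately show "\<exists>U\<in>delta_covers \<delta> E. (\<Sum>i. diam_powr (U i) t) \<le> ennreal e"
    by blast
qed

lemma hausdorff_measure_vertical_segment:
  fixes x :: real
  assumes "t > 1"
  shows "hausdorff_measure t ({x} \<times> {0..1::real}) = 0"
proof (rule hausdorff_measure_eq_0_of_finite_covers
    [where K = "\<lambda>n. 2 * real (Suc n)" and r = "\<lambda>n. 1 / real (Suc n)"])
  show "t > 0" using assms by simp
  show "(\<lambda>n. 1 / real (Suc n)) \<longlonglongrightarrow> 0"
    using LIMSEQ_inverse_real_of_nat by (simp add: inverse_eq_divide)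
  have "(\<lambda>n. 2 * real (Suc n) powr (1 - t)) \<longlonglongrightarrow> 2 * 0"
    using assms by (intro tendsto_mult tendsto_const tendsto_neg_powr
        filterlim_compose[OF filterlim_real_sequentially filterlim_Suc]) simp
  moreover have "2 * real (Suc n) * (1 / real (Suc n)) powr t = 2 * real (Suc n) powr (1 - t)" for n
    by (simp add: powr_diff powr_divide)
  ultimately show "(\<lambda>n. 2 * real (Suc n) * (1 / real (Suc n)) powr t) \<longlonglongrightarrow> 0"
    by simp
next
  fix n :: nat
  define w where "w = real (Suc n)"
  have w: "w > 0" by (simp add: w_def)
  \<comment> \<open>Pieces of height \<open>1 / (n + 1)\<close>, so \<open>2 * (n + 1)\<close>
    generously bounds the number \<open>n + 2\<close> of pieces used and the weight decays like
    \<open>(n + 1) powr (1 - t)\<close>.\<close>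
  define P where "P k = {x} \<times> {real k / w..(real k + 1) / w}" for k :: nat
  have "bounded (P k) \<and> diameter (P k) \<le> 1 / w" for k
  proof
    show "bounded (P k)" unfolding P_def by (intro bounded_Times) auto
    show "diameter (P k) \<le> 1 / w"
    proof (rule diameter_le)
      show "P k \<noteq> {} \<or> 0 \<le> 1 / w" using w by simp
      fix p q assume "p \<in> P k" "q \<in> P k"
      then show "norm (p - q) \<le> 1 / w"
        using w by (auto simp: P_def norm_Pair abs_le_iff diff_divide_distrib add_divide_distrib)
    qed
  qed
  \<comment> \<open>The extra index \<open>n + 1\<close> is reached at the top endpoint
    \<open>y = 1\<close>.\<close>
  moreover have "{x} \<times> {0..1} \<subseteq> \<Union>(P ` {..n+1})"
  proof
    fix p assume "p \<in> {x} \<times> {0..1::real}"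
    then obtain y where p: "p = (x, y)" and y: "0 \<le> y" "y \<le> 1" by auto
    define k where "k = nat \<lfloor>y * w\<rfloor>"
    have k: "real k \<le> y * w" "y * w < real k + 1"
      using y w unfolding k_def by (auto simp: of_nat_nat)
    have "y * w \<le> w" using y w by simp
    with k(1) have "real k \<le> real (n + 1)" unfolding w_def by linarith
    then have "k \<le> n + 1" by (simp only: of_nat_le_iff)
    moreover have "p \<in> P k" using k w by (auto simp: P_def p field_simps)
    ultimately show "p \<in> \<Union>(P ` {..n+1})" by blast
  qed
  moreover have "real (card (P ` {..n+1})) \<le> 2 * real (Suc n)"
    using card_image_le[of "{..n+1}" P] by simp
  ultimately show "\<exists>\<U>. finite \<U> \<and> real (card \<U>) \<le> 2 * real (Suc n) \<and> {x} \<times> {0..1::real} \<subseteq> \<Union>\<U> \<and>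
      (\<forall>U\<in>\<U>. bounded U \<and> diameter U \<le> 1 / real (Suc n))"
    by (intro exI[of _ "P ` {..n+1}"]) (auto simp: w_def)
qed

text \<open>Allows the upper bound to discard the fibres over countably many abscissas: its
  exponents all exceed 1.\<close>

lemma hausdorff_measure_countable_verticals:
  fixes X :: "real set"
  assumes "countable X" "t > 1"
  shows "hausdorff_measure t (X \<times> {0..1::real}) = 0"
proof (cases "X = {}")
  case True
  have "{} \<subseteq> {0::real} \<times> {0..1::real}" by simp
  then have "hausdorff_measure t ({} :: (real \<times> real) set) \<le> hausdorff_measure t ({0::real} \<times> {0..1::real})"
    by (rule hausdorff_measure_mono)
  then show ?thesis
    using True hausdorff_measure_vertical_segment[OF \<open>t > 1\<close>, of 0] by simp
next
  case False
  then have "X \<times> {0..1} = (\<Union>n. {from_nat_into X n} \<times> {0..1::real})"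
    using \<open>countable X\<close> range_from_nat_into[of X] by blast
  moreover have "hausdorff_measure t (\<Union>n. {from_nat_into X n} \<times> {0..1::real}) = 0"
    by (intro hausdorff_measure_UN_eq_0 hausdorff_measure_vertical_segment assms(2))
  ultimately show ?thesis by simp
qed

section \<open>Functions of bounded variation and covers of their graphs\<close>

text \<open>The total variation of \<open>f\<close> on \<open>A\<close> is at most \<open>M\<close>, with a monotone witness: cutting the range
  of \<open>x + h x\<close> into equal pieces then covers the graph of \<open>f\<close> economically.\<close>

definition controlled :: "real set \<Rightarrow> real \<Rightarrow> (real \<Rightarrow> real) \<Rightarrow> bool" where
  "controlled A M f \<longleftrightarrow> (\<exists>h. mono_on A h \<and> h ` A \<subseteq> {0..M} \<and>
     (\<forall>x\<in>A. \<forall>y\<in>A. \<bar>f x - f y\<bar> \<le> \<bar>h x - h y\<bar>))"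

lemma controlled_const:
  assumes "0 \<le> M"
  shows "controlled A M (\<lambda>x. k)"
  unfolding controlled_def
  using assms by (intro exI[of _ "\<lambda>x. 0"]) (auto simp: monotone_on_def)

lemma controlled_monotone:
  assumes "mono_on A f \<or> antimono_on A f" and "f ` A \<subseteq> {p..q}"
  shows "controlled A (q - p) f"
  using assms(1)
proof
  assume "mono_on A f"
  then show ?thesis
    unfolding controlled_def using assms(2)
    by (intro exI[of _ "\<lambda>x. f x - p"]) (auto simp: monotone_on_def image_subset_iff)
next
  assume "antimono_on A f"
  then show ?thesis
    unfolding controlled_def using assms(2)
    by (intro exI[of _ "\<lambda>x. q - f x"]) (auto simp: monotone_on_def image_subset_iff)
qed

text \<open>Both witnesses increase together, so their increments have equal signs and add up
  without cancellation.\<close>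

lemma controlled_add:
  assumes "controlled A M f" "controlled A N g"
  shows "controlled A (M + N) (\<lambda>x. f x + g x)"
proof -
  obtain h where h: "mono_on A h" "h ` A \<subseteq> {0..M}"
      "\<And>x y. x \<in> A \<Longrightarrow> y \<in> A \<Longrightarrow> \<bar>f x - f y\<bar> \<le> \<bar>h x - h y\<bar>"
    using assms(1) unfolding controlled_def by blast
  obtain k where k: "mono_on A k" "k ` A \<subseteq> {0..N}"
      "\<And>x y. x \<in> A \<Longrightarrow> y \<in> A \<Longrightarrow> \<bar>g x - g y\<bar> \<le> \<bar>k x - k y\<bar>"
    using assms(2) unfolding controlled_def by blast
  have "\<bar>f x + g x - (f y + g y)\<bar> \<le> \<bar>h x + k x - (h y + k y)\<bar>" if "x \<in> A" "y \<in> A" for x y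
  proof -
    have "(h x \<le> h y \<and> k x \<le> k y) \<or> (h y \<le> h x \<and> k y \<le> k x)"
      using h(1) k(1) that unfolding monotone_on_def by (meson linear)
    then show ?thesis
      using h(3)[OF that] k(3)[OF that] by linarith
  qed
  moreover have "mono_on A (\<lambda>x. h x + k x)"
    using h(1) k(1) by (auto simp: monotone_on_def intro: add_mono)
  moreover have "(\<lambda>x. h x + k x) ` A \<subseteq> {0..M + N}"
    using h(2) k(2) by (auto simp: image_subset_iff intro: add_mono)
  ultimately show ?thesis
    unfolding controlled_def by blast
qed

lemma controlled_scale:
  assumes "controlled A M f" "0 \<le> k"
  shows "controlled A (k * M) (\<lambda>x. k * f x)"
proof -
  obtain h where h: "mono_on A h" "h ` A \<subseteq> {0..M}"
      "\<And>x y. x \<in> A \<Longrightarrow> y \<in> A \<Longrightarrow> \<bar>f x - f y\<bar> \<le> \<bar>h x - h y\<bar>"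
    using assms(1) unfolding controlled_def by blast
  have "\<bar>k * f x - k * f y\<bar> \<le> \<bar>k * h x - k * h y\<bar>" if "x \<in> A" "y \<in> A" for x y
    using mult_left_mono[OF h(3)[OF that] assms(2)] assms(2)
    by (simp add: abs_mult flip: right_diff_distrib)
  moreover have "mono_on A (\<lambda>x. k * h x)"
    using h(1) assms(2) by (auto simp: monotone_on_def intro: mult_left_mono)
  moreover have "(\<lambda>x. k * h x) ` A \<subseteq> {0..k * M}"
    using h(2) assms(2) by (auto simp: image_subset_iff intro: mult_left_mono)
  ultimately show ?thesis
    unfolding controlled_def by blast
qed

text \<open>Variation does not grow under a monotone change of variable. If \<open>S\<close>
  reverses the order, the reflected witness \<open>M - h (S x)\<close> is increasing again with the
  same range.\<close>

lemma controlled_comp: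
  assumes "controlled A M f" and "mono_on B S \<or> antimono_on B S" and "S ` B \<subseteq> A"
  shows "controlled B M (\<lambda>x. f (S x))"
proof -
  obtain h where h: "mono_on A h" "h ` A \<subseteq> {0..M}"
      "\<And>x y. x \<in> A \<Longrightarrow> y \<in> A \<Longrightarrow> \<bar>f x - f y\<bar> \<le> \<bar>h x - h y\<bar>"
    using assms(1) unfolding controlled_def by blast
  from assms(2) show ?thesis
  proof
    assume "mono_on B S"
    then show ?thesis
      unfolding controlled_def using h assms(3)
      by (intro exI[of _ "\<lambda>x. h (S x)"]) (auto simp: monotone_on_def image_subset_iff)
  next
    assume "antimono_on B S"
    moreover have "\<bar>f (S x) - f (S y)\<bar> \<le> \<bar>M - h (S x) - (M - h (S y))\<bar>"
      if "x \<in> B" "y \<in> B" for x y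
      using h(3)[of "S x" "S y"] assms(3) that by (auto simp: abs_minus_commute)
    ultimately show ?thesis
      unfolding controlled_def using h(1,2) assms(3)
      by (intro exI[of _ "\<lambda>x. M - h (S x)"]) (auto simp: monotone_on_def image_subset_iff)
  qed
qed

lemma controlled_weaken:
  assumes "controlled A M f" "M \<le> N"
  shows "controlled A N f"
proof -
  have "{0..M} \<subseteq> {0..N}" using assms(2) by simp
  then show ?thesis
    using assms(1) unfolding controlled_def by (meson order_trans)
qed

text \<open>The increasing function \<open>u\<close> dominates the increments of both the abscissa
  and \<open>G\<close>, even across jumps of \<open>G\<close>. Its values fill at most a length
  \<open>b - a + M\<close>, and each piece of length \<delta> yields one covering set.\<close>

lemma controlled_graph_cover:
  fixes a b \<delta> :: real
  assumes "controlled {a..b} M G" and "0 < \<delta>" and "a \<le> b"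
  shows "\<exists>\<U>. finite \<U> \<and> real (card \<U>) \<le> (b - a + M) / \<delta> + 1 \<and>
    {p. fst p \<in> {a..b} \<and> \<bar>snd p - G (fst p)\<bar> \<le> \<delta>} \<subseteq> \<Union>\<U> \<and>
    (\<forall>U\<in>\<U>. bounded U \<and> diameter U \<le> 4 * \<delta>)"
proof -
  obtain h where h: "mono_on {a..b} h" "h ` {a..b} \<subseteq> {0..M}"
      "\<And>x y. x \<in> {a..b} \<Longrightarrow> y \<in> {a..b} \<Longrightarrow> \<bar>G x - G y\<bar> \<le> \<bar>h x - h y\<bar>"
    using assms(1) unfolding controlled_def by blast
  define u where "u x = x - a + h x" for x
  have u_bound: "0 \<le> u x" "u x \<le> b - a + M" if "x \<in> {a..b}" for x
    using h(2) that by (auto simp: u_def image_subset_iff intro: add_mono)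
  have u_dom: "\<bar>x - y\<bar> \<le> \<bar>u x - u y\<bar>" "\<bar>G x - G y\<bar> \<le> \<bar>u x - u y\<bar>"
    if "x \<in> {a..b}" "y \<in> {a..b}" for x y
  proof -
    have "(x \<le> y \<and> h x \<le> h y) \<or> (y \<le> x \<and> h y \<le> h x)"
      using h(1) that unfolding monotone_on_def by (meson linear)
    then show "\<bar>x - y\<bar> \<le> \<bar>u x - u y\<bar>" "\<bar>G x - G y\<bar> \<le> \<bar>u x - u y\<bar>"
      using h(3)[OF that] by (auto simp: u_def)
  qed
  define P where "P m = {p. fst p \<in> {a..b} \<and> \<bar>snd p - G (fst p)\<bar> \<le> \<delta> \<and>
    u (fst p) \<in> {real m * \<delta>..(real m + 1) * \<delta>}}" for m :: nat
  define N where "N = nat \<lfloor>(b - a + M) / \<delta>\<rfloor>"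
  have near: "norm (p - q) \<le> 4 * \<delta>" if "p \<in> P m" "q \<in> P m" for p q m
  proof -
    have "\<bar>u (fst p) - u (fst q)\<bar> \<le> \<delta>"
      using that unfolding P_def by (auto simp: algebra_simps abs_le_iff)
    then have "\<bar>fst p - fst q\<bar> \<le> \<delta>" "\<bar>G (fst p) - G (fst q)\<bar> \<le> \<delta>"
      using u_dom[of "fst p" "fst q"] that unfolding P_def by auto
    \<comment> \<open>The vertical 3\<delta> is \<delta> for the change of \<open>G\<close> and
      \<delta> for the distance of each of the two points from the graph; the horizontal \<delta>
      brings the total to 4\<delta>.\<close>
    then have "\<bar>fst p - fst q\<bar> \<le> \<delta>" "\<bar>snd p - snd q\<bar> \<le> 3 * \<delta>"
      using that unfolding P_def by auto
    moreover have "norm (p - q) \<le> norm (fst p - fst q) + norm (snd p - snd q)"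
      by (metis fst_diff norm_Pair_le prod.collapse snd_diff)
    ultimately show ?thesis by simp
  qed
  have "bounded (P m) \<and> diameter (P m) \<le> 4 * \<delta>" for m
  proof
    show "bounded (P m)"
      using near unfolding bounded_def dist_norm by blast
    show "diameter (P m) \<le> 4 * \<delta>"
      using near \<open>0 < \<delta>\<close> by (intro diameter_le) auto
  qed
  moreover have "{p. fst p \<in> {a..b} \<and> \<bar>snd p - G (fst p)\<bar> \<le> \<delta>} \<subseteq> \<Union>(P ` {..N})"
  proof
    fix p assume p: "p \<in> {p. fst p \<in> {a..b} \<and> \<bar>snd p - G (fst p)\<bar> \<le> \<delta>}"
    define m where "m = nat \<lfloor>u (fst p) / \<delta>\<rfloor>"
    have ub: "0 \<le> u (fst p)" "u (fst p) \<le> b - a + M"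
      using p u_bound[of "fst p"] by auto
    have "m \<le> N"
      unfolding m_def N_def using ub \<open>0 < \<delta>\<close> by (intro nat_mono floor_mono divide_right_mono) auto
    moreover have "real m \<le> u (fst p) / \<delta>" "u (fst p) / \<delta> \<le> real m + 1"
      using ub \<open>0 < \<delta>\<close> unfolding m_def by (auto simp: of_nat_nat) 
    then have "p \<in> P m"
      using p \<open>0 < \<delta>\<close> by (simp add: P_def field_simps)
    ultimately show "p \<in> \<Union>(P ` {..N})" by blast
  qed
  moreover have "real (card (P ` {..N})) \<le> (b - a + M) / \<delta> + 1"
  proof -
    have "0 \<le> b - a + M"
      using u_bound[of a] \<open>a \<le> b\<close> by simp
    then have "real N \<le> (b - a + M) / \<delta>"
      using \<open>0 < \<delta>\<close> by (simp add: N_def of_nat_nat)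
    moreover have "card (P ` {..N}) \<le> N + 1"
      using card_image_le[of "{..N}" P] by simp
    ultimately show ?thesis by linarith
  qed
  ultimately show ?thesis
    by (intro exI[of _ "P ` {..N}"]) auto
qed

text \<open>The variation budget 1 reproduces itself: \<open>\<phi> (S x)\<close> contributes at
  most \<open>(1 - l) / 2\<close> and the scaled \<open>G\<close> at most \<open>l\<close>, together
  \<open>(1 + l) / 2\<close>. This makes the variation bound uniform over all iterates.\<close>

lemma controlled_branches_step:
  assumes "controlled A 1 G" and S: "mono_on A S \<or> antimono_on A S" "S ` A \<subseteq> A"
    and \<phi>: "mono_on A \<phi> \<or> antimono_on A \<phi>" "\<phi> ` A \<subseteq> {1/2..1 - l/2}" and l: "0 \<le> l" "l \<le> 1"
  shows "controlled A 1 (\<lambda>x. \<phi> (S x) + l * (G (S x) - 1/2))"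
proof -
  have "controlled A ((1 - l/2) - 1/2) (\<lambda>x. \<phi> (S x))"
    by (rule controlled_comp[OF controlled_monotone[OF \<phi>] S])
  moreover have "controlled A 1 (\<lambda>x. G (S x))"
    by (rule controlled_comp[OF assms(1) S])
  then have "controlled A (l * 1) (\<lambda>x. l * G (S x))"
    using l(1) by (rule controlled_scale)
  ultimately have "controlled A ((1 - l/2) - 1/2 + l * 1 + 0)
      (\<lambda>x. (\<phi> (S x) + l * G (S x)) + - (l / 2))"
    by (intro controlled_add[OF controlled_add controlled_const] order_refl)
  moreover have "(1 - l/2) - 1/2 + l * 1 + 0 \<le> 1"
    using l by simp
  ultimately have "controlled A 1 (\<lambda>x. (\<phi> (S x) + l * G (S x)) + - (l / 2))"
    by (rule controlled_weaken)
  moreover have "(\<phi> (S x) + l * G (S x)) + - (l / 2) = \<phi> (S x) + l * (G (S x) - 1/2)" for x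
    by (simp add: right_diff_distrib)
  ultimately show ?thesis by (simp only:)
qed

section \<open>Preimages under monotone maps\<close>

text \<open>\<open>T\<close> may have flat pieces, so the inverse is a choice. Two chosen preimages
  in the wrong order would force equal images, hence would be the same preimage.\<close>

lemma inv_into_monotone:
  fixes T :: "real \<Rightarrow> real"
  assumes "mono_on A T \<or> antimono_on A T" and "T ` A = B"
  shows "mono_on B (inv_into A T) \<or> antimono_on B (inv_into A T)"
proof -
  let ?S = "inv_into A T"
  have S: "?S x \<in> A" "T (?S x) = x" if "x \<in> B" for x
    using that assms(2) by (auto simp: inv_into_into f_inv_into_f)
  from assms(1) show ?thesis
  proof
    assume T: "mono_on A T"
    have "?S x \<le> ?S y" if "x \<in> B" "y \<in> B" "x \<le> y" for x y
    proof (rule ccontr)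
      assume neg: "\<not> ?S x \<le> ?S y"
      then have "?S y \<le> ?S x" by simp
      from monotone_onD[OF T S(1)[OF \<open>y \<in> B\<close>] S(1)[OF \<open>x \<in> B\<close>] this]
      have "x = y" using S(2)[OF that(1)] S(2)[OF that(2)] that(3) by simp
      with neg show False by simp
    qed
    then show ?thesis by (auto simp: monotone_on_def)
  next
    assume T: "antimono_on A T"
    have "?S y \<le> ?S x" if "x \<in> B" "y \<in> B" "x \<le> y" for x y
    proof (rule ccontr)
      assume neg: "\<not> ?S y \<le> ?S x"
      then have "?S x \<le> ?S y" by simp
      from monotone_onD[OF T S(1)[OF \<open>x \<in> B\<close>] S(1)[OF \<open>y \<in> B\<close>] this]
      have "x = y" using S(2)[OF that(1)] S(2)[OF that(2)] that(3) by simp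
      with neg show False by simp
    qed
    then show ?thesis by (auto simp: monotone_on_def)
  qed
qed

text \<open>A monotone function with equal values at two points is constant between them, and so
  takes this value at a rational number.\<close>

lemma monotone_preimage_unique:
  fixes T :: "real \<Rightarrow> real"
  assumes "mono_on {p..q} T \<or> antimono_on {p..q} T" "x \<in> {p..q}" "y \<in> {p..q}" "T x = T y" "T x \<notin> T ` \<rat>"
  shows "x = y"
proof (rule ccontr)
  assume "x \<noteq> y"
  then have "min x y < max x y" by auto
  then obtain r where r: "min x y < real_of_rat r" "real_of_rat r < max x y"
    using of_rat_dense by blast
  have "T (real_of_rat r) = T x"
    using assms(1)
  proof
    assume m: "mono_on {p..q} T"
    have "T (min x y) \<le> T (real_of_rat r)" "T (real_of_rat r) \<le> T (max x y)"
      by (rule monotone_onD[OF m]; use r assms(2,3) in \<open>auto simp: min_def max_def split: if_splits\<close>)+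
    then show ?thesis using assms(4) by (auto simp: min_def max_def split: if_splits)
  next
    assume m: "antimono_on {p..q} T"
    have "T (min x y) \<ge> T (real_of_rat r)" "T (real_of_rat r) \<ge> T (max x y)"
      by (rule monotone_onD[OF m]; use r assms(2,3) in \<open>auto simp: min_def max_def split: if_splits\<close>)+
    then show ?thesis using assms(4) by (auto simp: min_def max_def split: if_splits)
  qed
  then show False using assms(5) by (metis Rats_of_rat imageI)
qed

text \<open>Reduces all exponents below the critical one to the critical one: for diameters at most
  1, lowering the exponent only increases the weight. At \<open>t = 0\<close> the weight of a
  nonempty set is 1, which dominates as well.\<close>

lemma diam_powr_ge:
  assumes "0 \<le> t" "t \<le> u" "0 < u" "bounded U" "diameter U \<le> 1"
  shows "ennreal (diameter U powr u) \<le> diam_powr U t"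
proof (cases "U = {} \<or> t = 0")
  case True
  then show ?thesis
    using assms diameter_ge_0[OF assms(4)] powr_le1[of u "diameter U"]
    by (auto simp: diam_powr_def ennreal_le_1)
next
  case False
  then show ?thesis
    using assms diameter_ge_0[OF assms(4)]
    by (auto simp: diam_powr_def intro!: ennreal_leI powr_mono')
qed

section \<open>The skew product, its constants and its inverse branches\<close>

locale skew_baker_map =
  fixes a b c d lam :: real and T \<phi> :: "real \<Rightarrow> real" and F :: "real \<times> real \<Rightarrow> real \<times> real"
  assumes ac: "a < c" and cd: "c < d" and db: "d < b"
    and T_left: "mono_on {a..c} T \<or> antimono_on {a..c} T" "T ` {a..c} = {a..b}"
    and T_right: "mono_on {d..b} T \<or> antimono_on {d..b} T" "T ` {d..b} = {a..b}"
    and T_gap: "T ` {c<..<d} \<subseteq> {a, b}"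
    and lam: "0 < lam" "lam < 1 / 2"
    and phi_range: "\<phi> ` {a..b} \<subseteq> {1 / 2..1 - lam / 2}"
    and phi_mono: "mono_on {a..b} \<phi> \<or> antimono_on {a..b} \<phi>"
    and phi_gap: "\<bar>\<phi> c - \<phi> d\<bar> > lam"
    and F_eq: "\<And>x y. x \<in> {a..b} \<Longrightarrow> y \<in> {0..1} \<Longrightarrow> F (x, y) = (T x, \<phi> x + lam * (y - 1 / 2))"
begin

definition Q :: "(real \<times> real) set" where "Q = {a..b} \<times> {0..1}"

definition attractor :: "(real \<times> real) set" where "attractor = (\<Inter>n. (F ^^ n) ` Q)"

text \<open>\<open>F\<close> maps a fibre over \<open>z\<close> to an interval of length
  \<open>lam\<close> centred at \<open>\<phi> z\<close>. For one \<open>z\<close> in each lap the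
  centres differ by at least \<open>\<bar>\<phi> c - \<phi> d\<bar>\<close>, so \<open>gap\<close>
  bounds the space left between the two intervals from below.\<close>

definition gap :: real where "gap = \<bar>\<phi> c - \<phi> d\<bar> - lam"

text \<open>Similarity dimension of a Cantor set built from two contractions of ratio
  \<open>lam\<close>, the solution of \<open>2 * lam powr s = 1\<close>.\<close>

definition s :: real where "s = ln 2 / (- ln lam)"

definition left_branch :: "real \<Rightarrow> real" where "left_branch = inv_into {a..c} T"

definition right_branch :: "real \<Rightarrow> real" where "right_branch = inv_into {d..b} T"

lemma left_branch:
  assumes "x \<in> {a..b}"
  shows "left_branch x \<in> {a..c}" "T (left_branch x) = x"
proof -
  have "x \<in> T ` {a..c}" using assms T_left(2) by simp
  then show "left_branch x \<in> {a..c}" "T (left_branch x) = x"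
    unfolding left_branch_def by (rule inv_into_into, rule f_inv_into_f)
qed

lemma right_branch:
  assumes "x \<in> {a..b}"
  shows "right_branch x \<in> {d..b}" "T (right_branch x) = x"
proof -
  have "x \<in> T ` {d..b}" using assms T_right(2) by simp
  then show "right_branch x \<in> {d..b}" "T (right_branch x) = x"
    unfolding right_branch_def by (rule inv_into_into, rule f_inv_into_f)
qed

lemma branch_image: "left_branch ` {a..b} \<subseteq> {a..b}" "right_branch ` {a..b} \<subseteq> {a..b}"
proof -
  show "left_branch ` {a..b} \<subseteq> {a..b}"
  proof
    fix y assume "y \<in> left_branch ` {a..b}"
    then have "y \<in> {a..c}" using left_branch(1) by blast
    then show "y \<in> {a..b}" using cd db by simp
  qed
  show "right_branch ` {a..b} \<subseteq> {a..b}"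
  proof
    fix y assume "y \<in> right_branch ` {a..b}"
    then have "y \<in> {d..b}" using right_branch(1) by blast
    then show "y \<in> {a..b}" using ac cd by simp
  qed
qed

lemma branch_mono:
  "mono_on {a..b} left_branch \<or> antimono_on {a..b} left_branch"
  "mono_on {a..b} right_branch \<or> antimono_on {a..b} right_branch"
  unfolding left_branch_def right_branch_def
  by (rule inv_into_monotone[OF T_left], rule inv_into_monotone[OF T_right])

lemma phi_bounds:
  assumes "x \<in> {a..b}"
  shows "1 / 2 \<le> \<phi> x" "\<phi> x \<le> 1 - lam / 2"
  using assms phi_range by (auto simp only: image_subset_iff atLeastAtMost_iff)

lemma gap_pos: "gap > 0"
  using phi_gap by (simp add: gap_def)

lemma s_pos: "s > 0"
  unfolding s_def using lam by (intro divide_pos_pos) auto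

lemma lam_powr_s: "lam powr s = 1 / 2"
proof -
  have "ln lam \<noteq> 0" using lam by simp
  then have "lam powr s = exp (- ln 2)"
    using lam by (simp add: powr_def s_def)
  then show ?thesis by (simp add: exp_minus)
qed

text \<open>Off this countable set of abscissas every backward \<open>T\<close>-orbit is a composition of the two
  inverse branches: a value that \<open>T\<close> takes twice on a lap is taken on an interval, hence at a
  rational.\<close>

definition exceptional :: "real set" where
  "exceptional = (\<Union>n. (T ^^ n) ` (\<rat> \<union> {a, b}))"

lemma countable_exceptional: "countable exceptional"
  unfolding exceptional_def by (intro countable_UN countable_image) (auto simp: countable_rat)

text \<open>The exceptional set is forward invariant, so its complement is closed under preimages.
  It contains \<open>a\<close> and \<open>b\<close>, which rules out preimages in the middle
  interval; on either lap \<open>monotone_preimage_unique\<close> identifies the preimage with the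
  chosen one.\<close>

lemma preimage_not_exceptional:
  assumes "z \<in> {a..b}" "T z \<notin> exceptional"
  shows "z \<notin> exceptional" and "z = left_branch (T z) \<or> z = right_branch (T z)"
proof -
  have step: "T w \<in> exceptional" if "w \<in> exceptional" for w
  proof -
    from that obtain n q where "q \<in> \<rat> \<union> {a, b}" "w = (T ^^ n) q"
      unfolding exceptional_def by blast
    then have "T w = (T ^^ Suc n) q" "q \<in> \<rat> \<union> {a, b}" by simp_all
    then show ?thesis unfolding exceptional_def by blast
  qed
  then show "z \<notin> exceptional" using assms(2) by blast
  have base: "w \<in> exceptional" if "w \<in> \<rat> \<union> {a, b}" for w
    using that unfolding exceptional_def by (intro UN_I[of 0]) auto
  have rat: "T z \<notin> T ` \<rat>"
  proof
    assume "T z \<in> T ` \<rat>"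
    then obtain r where "T z = T r" "r \<in> \<rat>" by (rule imageE)
    then show False using step[OF base, of r] assms(2) by simp
  qed
  have Tz: "T z \<notin> {a, b}" using base[of "T z"] assms(2) by auto
  then have "z \<notin> {c<..<d}" using T_gap by blast
  then consider "z \<in> {a..c}" | "z \<in> {d..b}" using assms(1) by fastforce
  then show "z = left_branch (T z) \<or> z = right_branch (T z)"
  proof cases
    case 1
    then have Tz_in: "T z \<in> {a..b}" using T_left(2) by blast
    have "z = left_branch (T z)"
      by (rule monotone_preimage_unique[OF T_left(1) 1 left_branch(1)[OF Tz_in]
            left_branch(2)[OF Tz_in, symmetric] rat])
    then show ?thesis ..
  next
    case 2
    then have Tz_in: "T z \<in> {a..b}" using T_right(2) by blast
    have "z = right_branch (T z)"
      by (rule monotone_preimage_unique[OF T_right(1) 2 right_branch(1)[OF Tz_in]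
            right_branch(2)[OF Tz_in, symmetric] rat])
    then show ?thesis ..
  qed
qed

section \<open>Upper bound: iterated images of \<open>Q\<close> and their covers\<close>

lemma T_maps: "x \<in> {a..b} \<Longrightarrow> T x \<in> {a..b}"
proof -
  assume "x \<in> {a..b}"
  then consider "x \<in> {a..c}" | "x \<in> {c<..<d}" | "x \<in> {d..b}" by fastforce
  then show "T x \<in> {a..b}"
    using T_left(2) T_right(2) T_gap ac cd db by cases fastforce+
qed

lemma F_maps:
  assumes "p \<in> Q" shows "F p \<in> Q"
proof -
  obtain x y where p: "p = (x, y)" "x \<in> {a..b}" "0 \<le> y" "y \<le> 1"
    using assms by (auto simp: Q_def)
  have "\<bar>y - 1/2\<bar> \<le> 1/2"
    unfolding abs_le_iff using p by simp
  then have "\<bar>lam * (y - 1/2)\<bar> \<le> lam * (1/2)"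
    using lam unfolding abs_mult by simp
  then show ?thesis
    using p F_eq[of x y] phi_bounds[of x] T_maps[of x] lam by (auto simp: Q_def abs_le_iff)
qed

lemma F_image_Suc: "(F ^^ Suc n) ` Q = F ` (F ^^ n) ` Q"
  by (simp add: image_comp)

lemma F_iterates_subset: "(F ^^ n) ` Q \<subseteq> Q"
proof (induction n)
  case (Suc n)
  then show ?case unfolding F_image_Suc using F_maps by blast
qed simp

text \<open>Each application of \<open>F\<close> pushes every graph forward along both inverse
  branches, which doubles the number of graphs, and contracts vertical distances by
  \<open>lam\<close>.\<close>

lemma iterate_near_graphs:
  "\<exists>\<G>. finite \<G> \<and> card \<G> \<le> 2 ^ n \<and> (\<forall>G\<in>\<G>. controlled {a..b} 1 G) \<and>
     (\<forall>p\<in>(F ^^ n) ` Q. fst p \<notin> exceptional \<longrightarrow> (\<exists>G\<in>\<G>. \<bar>snd p - G (fst p)\<bar> \<le> lam ^ n))"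
proof (induction n)
  case 0
  \<comment> \<open>Every height in the unit interval is within \<open>lam ^ 0 = 1\<close> of
    1/2.\<close>
  show ?case
    by (intro exI[of _ "{\<lambda>x. 1/2}"]) (auto simp: controlled_const Q_def abs_le_iff)
next
  case (Suc n)
  then obtain \<G> where \<G>: "finite \<G>" "card \<G> \<le> 2 ^ n"
      "\<And>G. G \<in> \<G> \<Longrightarrow> controlled {a..b} 1 G"
      "\<And>p. p \<in> (F ^^ n) ` Q \<Longrightarrow> fst p \<notin> exceptional \<Longrightarrow> \<exists>G\<in>\<G>. \<bar>snd p - G (fst p)\<bar> \<le> lam ^ n"
    by blast
  \<comment> \<open>Graph transform: the second coordinate of \<open>F\<close>, evaluated at the
    point \<open>(S x, G (S x))\<close> over the preimage \<open>S x\<close> of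
    \<open>x\<close>.\<close>
  define lift where "lift S G = (\<lambda>x. \<phi> (S x) + lam * (G (S x) - 1/2))" for S G :: "real \<Rightarrow> real"
  define \<H> where "\<H> = lift left_branch ` \<G> \<union> lift right_branch ` \<G>"
  have fin: "finite \<H>"
    using \<G>(1) by (simp add: \<H>_def)
  have "card \<H> \<le> card \<G> + card \<G>"
    using \<G>(1) unfolding \<H>_def by (meson add_mono card_Un_le card_image_le order_trans)
  then have "card \<H> \<le> 2 ^ Suc n" using \<G>(2) by simp
  moreover have "controlled {a..b} 1 H" if H: "H \<in> \<H>" for H
  proof -
    have l: "0 \<le> lam" "lam \<le> 1" using lam by simp_all
    obtain G where "G \<in> \<G>" "H = lift left_branch G \<or> H = lift right_branch G"
      using H unfolding \<H>_def by blast
    then show ?thesis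
      unfolding lift_def
      using controlled_branches_step[OF \<G>(3) branch_mono(1) branch_image(1) phi_mono phi_range l]
        controlled_branches_step[OF \<G>(3) branch_mono(2) branch_image(2) phi_mono phi_range l]
      by blast
  qed
  moreover have "\<exists>H\<in>\<H>. \<bar>snd p - H (fst p)\<bar> \<le> lam ^ Suc n"
    if p: "p \<in> (F ^^ Suc n) ` Q" "fst p \<notin> exceptional" for p
  proof -
    obtain q where q: "q \<in> (F ^^ n) ` Q" "p = F q" using p(1) unfolding F_image_Suc by blast
    obtain z w where zw: "q = (z, w)" "z \<in> {a..b}" "w \<in> {0..1}"
      using q(1) F_iterates_subset[of n] by (auto simp: Q_def)
    have pe: "p = (T z, \<phi> z + lam * (w - 1/2))"
      using q(2) zw F_eq by simp
    have z: "z \<notin> exceptional" "z = left_branch (T z) \<or> z = right_branch (T z)"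
      using preimage_not_exceptional[of z] zw(2) p(2) pe by auto
    obtain G where G: "G \<in> \<G>" "\<bar>w - G z\<bar> \<le> lam ^ n"
      using \<G>(4)[OF q(1)] z(1) zw(1) by auto
    obtain S where S: "lift S G \<in> \<H>" "S (T z) = z"
      using z(2) G(1) unfolding \<H>_def by fastforce
    \<comment> \<open>Since \<open>S (T z) = z\<close>, both sides carry the same term
      \<open>\<phi> z\<close>, which cancels.\<close>
    have "\<bar>snd p - lift S G (fst p)\<bar> = lam * \<bar>w - G z\<bar>"
      using lam by (simp add: pe lift_def S(2) abs_mult flip: right_diff_distrib)
    also have "\<dots> \<le> lam ^ Suc n"
      using G(2) lam by simp
    finally show ?thesis using S(1) by blast
  qed
  ultimately show ?case
    using fin by blast
qed

lemma iterate_cover: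
  "\<exists>\<U>. finite \<U> \<and> real (card \<U>) \<le> 2 ^ n * ((b - a + 1) / lam ^ n + 1) \<and>
     {p \<in> (F ^^ n) ` Q. fst p \<notin> exceptional} \<subseteq> \<Union>\<U> \<and>
     (\<forall>U\<in>\<U>. bounded U \<and> diameter U \<le> 4 * lam ^ n)"
proof -
  obtain \<G> where \<G>: "finite \<G>" "card \<G> \<le> 2 ^ n"
      "\<forall>G\<in>\<G>. controlled {a..b} 1 G"
      "\<forall>p\<in>(F ^^ n) ` Q. fst p \<notin> exceptional \<longrightarrow> (\<exists>G\<in>\<G>. \<bar>snd p - G (fst p)\<bar> \<le> lam ^ n)"
    using iterate_near_graphs[of n] by (elim exE conjE)
  let ?cover = "\<lambda>G \<U>. finite \<U> \<and> real (card \<U>) \<le> (b - a + 1) / lam ^ n + 1 \<and>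
    {p. fst p \<in> {a..b} \<and> \<bar>snd p - G (fst p)\<bar> \<le> lam ^ n} \<subseteq> \<Union>\<U> \<and>
    (\<forall>U\<in>\<U>. bounded U \<and> diameter U \<le> 4 * lam ^ n)"
  have "\<forall>G\<in>\<G>. \<exists>\<U>. ?cover G \<U>"
    using \<G>(3) lam ac cd db by (intro ballI controlled_graph_cover) auto
  then obtain \<U> where "\<forall>G\<in>\<G>. ?cover G (\<U> G)"
    by (rule bchoice[THEN exE])
  then have \<U>: "\<And>G. G \<in> \<G> \<Longrightarrow> finite (\<U> G)"
      "\<And>G. G \<in> \<G> \<Longrightarrow> real (card (\<U> G)) \<le> (b - a + 1) / lam ^ n + 1"
      "\<And>G. G \<in> \<G> \<Longrightarrow> {p. fst p \<in> {a..b} \<and> \<bar>snd p - G (fst p)\<bar> \<le> lam ^ n} \<subseteq> \<Union>(\<U> G)"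
      "\<And>G U. G \<in> \<G> \<Longrightarrow> U \<in> \<U> G \<Longrightarrow> bounded U \<and> diameter U \<le> 4 * lam ^ n"
    by blast+
  have "real (card (\<Union>(\<U> ` \<G>))) \<le> (\<Sum>G\<in>\<G>. real (card (\<U> G)))"
    using card_UN_le[OF \<G>(1), of \<U>] by (metis of_nat_le_iff of_nat_sum)
  also have "\<dots> \<le> real (card \<G>) * ((b - a + 1) / lam ^ n + 1)"
    using \<U>(2) by (rule sum_bounded_above)
  also have "\<dots> \<le> 2 ^ n * ((b - a + 1) / lam ^ n + 1)"
  proof (rule mult_right_mono)
    show "real (card \<G>) \<le> 2 ^ n"
      using \<G>(2) by (metis of_nat_le_iff of_nat_numeral of_nat_power)
    show "0 \<le> (b - a + 1) / lam ^ n + 1"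
      using ac cd db lam by simp
  qed
  finally have "real (card (\<Union>(\<U> ` \<G>))) \<le> 2 ^ n * ((b - a + 1) / lam ^ n + 1)" .
  moreover have "{p \<in> (F ^^ n) ` Q. fst p \<notin> exceptional} \<subseteq> \<Union>(\<Union>(\<U> ` \<G>))"
  proof
    fix p assume "p \<in> {p \<in> (F ^^ n) ` Q. fst p \<notin> exceptional}"
    then have p: "p \<in> (F ^^ n) ` Q" "fst p \<notin> exceptional" by auto
    then obtain G where G: "G \<in> \<G>" "\<bar>snd p - G (fst p)\<bar> \<le> lam ^ n"
      using \<G>(4) by blast
    have "fst p \<in> {a..b}"
      using p(1) F_iterates_subset[of n] by (auto simp: Q_def)
    then have "p \<in> \<Union>(\<U> G)" using \<U>(3)[OF G(1)] G(2) by blast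
    then show "p \<in> \<Union>(\<Union>(\<U> ` \<G>))" using G(1) by blast
  qed
  ultimately show ?thesis
    using \<G>(1) \<U>(1,4) by (intro exI[of _ "\<Union>(\<U> ` \<G>)"]) auto
qed

lemma hausdorff_measure_attractor_eq_0:
  assumes "t > 1 + s"
  shows "hausdorff_measure t attractor = 0"
proof -
  have t1: "t > 1" using assms s_pos by simp
  define L where "L = b - a + 1"
  have L: "L \<ge> 0" using ac cd db by (simp add: L_def)
  let ?E = "{p \<in> attractor. fst p \<notin> exceptional}"
  have "hausdorff_measure t ?E = 0"
  proof (rule hausdorff_measure_eq_0_of_finite_covers
      [where K = "\<lambda>n. 2 ^ n * ((L + 1) / lam ^ n)" and r = "\<lambda>n. 4 * lam ^ n"])
    show "t > 0" using t1 by simp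
    show "(\<lambda>n. 4 * lam ^ n) \<longlonglongrightarrow> 0"
      using lam by (intro tendsto_mult_right_zero LIMSEQ_power_zero) simp
    \<comment> \<open>About \<open>(2 / lam) ^ n\<close> sets of diameter about
      \<open>lam ^ n\<close> give a geometric sequence; its ratio
      \<open>2 * lam powr (t - 1)\<close> is below 1 because \<open>t - 1 > s\<close> and
      \<open>lam powr s = 1 / 2\<close>.\<close>
    have "2 ^ n * ((L + 1) / lam ^ n) * (4 * lam ^ n) powr t =
        (L + 1) * 4 powr t * (2 * lam powr (t - 1)) ^ n" for n
    proof -
      have "(lam ^ n) powr t = (lam powr t) ^ n"
        using lam by (simp add: powr_powr powr_power mult.commute flip: powr_realpow)
      moreover have "lam powr (t - 1) = lam powr t / lam"
        using lam by (simp add: powr_diff)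
      ultimately show ?thesis
        using lam by (simp add: powr_mult power_mult_distrib power_divide)
    qed
    moreover have "(\<lambda>n. (L + 1) * 4 powr t * (2 * lam powr (t - 1)) ^ n) \<longlonglongrightarrow> 0"
    proof (intro tendsto_mult_right_zero LIMSEQ_power_zero)
      have "lam powr (t - 1) < lam powr s"
        using assms lam by (intro powr_less_mono') auto
      then show "norm (2 * lam powr (t - 1)) < 1"
        by (simp add: lam_powr_s)
    qed
    ultimately show "(\<lambda>n. 2 ^ n * ((L + 1) / lam ^ n) * (4 * lam ^ n) powr t) \<longlonglongrightarrow> 0"
      by simp
  next
    fix n
    have sub: "?E \<subseteq> {p \<in> (F ^^ n) ` Q. fst p \<notin> exceptional}"
      unfolding attractor_def by blast
    \<comment> \<open>The summand 1 is absorbed into \<open>1 / lam ^ n\<close>, so that the bound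
      becomes purely geometric.\<close>
    have le: "2 ^ n * (L / lam ^ n + 1) \<le> 2 ^ n * ((L + 1) / lam ^ n)"
      using lam by (simp add: add_divide_distrib power_le_one)
    obtain \<U> where \<U>: "finite \<U>" "real (card \<U>) \<le> 2 ^ n * (L / lam ^ n + 1)"
        "{p \<in> (F ^^ n) ` Q. fst p \<notin> exceptional} \<subseteq> \<Union>\<U>"
        "\<forall>U\<in>\<U>. bounded U \<and> diameter U \<le> 4 * lam ^ n"
      using iterate_cover[of n] unfolding L_def by (elim exE conjE)
    show "\<exists>\<U>. finite \<U> \<and> real (card \<U>) \<le> 2 ^ n * ((L + 1) / lam ^ n) \<and>
        ?E \<subseteq> \<Union>\<U> \<and> (\<forall>U\<in>\<U>. bounded U \<and> diameter U \<le> 4 * lam ^ n)"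
      using \<U>(1) order_trans[OF \<U>(2) le] order_trans[OF sub \<U>(3)] \<U>(4)
      by (intro exI[of _ \<U>] conjI)
  qed
  moreover have "hausdorff_measure t (exceptional \<times> {0..1::real}) = 0"
    by (rule hausdorff_measure_countable_verticals[OF countable_exceptional t1])
  ultimately have "hausdorff_measure t (?E \<union> exceptional \<times> {0..1}) = 0"
    by (rule hausdorff_measure_Un_eq_0)
  moreover have "attractor \<subseteq> ?E \<union> exceptional \<times> {0..1}"
  proof
    fix p assume p: "p \<in> attractor"
    then have "p \<in> (F ^^ 0) ` Q" unfolding attractor_def by blast
    then have "snd p \<in> {0..1}" by (auto simp: Q_def)
    then show "p \<in> ?E \<union> exceptional \<times> {0..1}"
      using p by (cases p) auto
  qed
  ultimately show ?thesis
    using hausdorff_measure_mono[of attractor "?E \<union> exceptional \<times> {0..1}" t] by simp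
qed

section \<open>Lower bound: points of the attractor from binary itineraries\<close>

text \<open>The half-open second factor is invariant under doubling modulo 1, the digit
  shift.\<close>

definition D :: "(real \<times> real) set" where "D = {a..b} \<times> {0..<1}"

text \<open>Backward step along the itinerary given by the binary digits of the second coordinate; in this
  way Lebesgue measure on \<open>{0..<1}\<close> replaces the Bernoulli measure on itineraries.\<close>

definition pull :: "real \<times> real \<Rightarrow> real \<times> real" where
  "pull p = (if snd p < 1/2 then (left_branch (fst p), 2 * snd p)
             else (right_branch (fst p), 2 * snd p - 1))"

text \<open>The recursion of \<open>height_step\<close>, unrolled along the backward orbit. The
  shift by 1/2 in \<open>F\<close> is spread over the series as \<open>- lam / 2\<close> in each
  term.\<close>

definition height :: "real \<times> real \<Rightarrow> real" where
  "height p = (\<Sum>k. lam ^ k * (\<phi> (fst ((pull ^^ Suc k) p)) - lam / 2))"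

lemma pull_maps:
  assumes "p \<in> D" shows "pull p \<in> D"
  using assms branch_image left_branch[of "fst p"] right_branch[of "fst p"]
  by (auto simp: D_def pull_def image_subset_iff)

lemma T_fst_pull: "p \<in> D \<Longrightarrow> T (fst (pull p)) = fst p"
  using left_branch(2) right_branch(2) by (auto simp: D_def pull_def)

lemma pull_iterate: "p \<in> D \<Longrightarrow> (pull ^^ n) p \<in> D"
  by (induction n) (auto intro: pull_maps)

lemma height_term_bounds:
  assumes "p \<in> D"
  shows "0 \<le> lam ^ k * (\<phi> (fst ((pull ^^ Suc k) p)) - lam / 2)"
    and "lam ^ k * (\<phi> (fst ((pull ^^ Suc k) p)) - lam / 2) \<le> lam ^ k * (1 - lam)"
proof -
  have "fst ((pull ^^ Suc k) p) \<in> {a..b}"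
    using pull_iterate[OF assms, of "Suc k"] by (auto simp: D_def)
  from phi_bounds[OF this] 
  show "0 \<le> lam ^ k * (\<phi> (fst ((pull ^^ Suc k) p)) - lam / 2)"
    and "lam ^ k * (\<phi> (fst ((pull ^^ Suc k) p)) - lam / 2) \<le> lam ^ k * (1 - lam)"
    using lam by (auto intro!: mult_nonneg_nonneg mult_left_mono)
qed

text \<open>Used to fit the heights into the unit interval: \<open>\<phi> - lam / 2\<close> is at
  most \<open>1 - lam\<close>, and these bounds, weighted by \<open>lam ^ k\<close>, add up to
  exactly 1.\<close>

lemma geometric_majorant: "(\<lambda>k. lam ^ k * (1 - lam)) sums 1"
proof -
  have "(\<lambda>k. lam ^ k * (1 - lam)) sums (1 / (1 - lam) * (1 - lam))"
    using lam by (intro sums_mult2 geometric_sums) simp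
  then show ?thesis using lam by simp
qed

lemma summable_height:
  assumes "p \<in> D"
  shows "summable (\<lambda>k. lam ^ k * (\<phi> (fst ((pull ^^ Suc k) p)) - lam / 2))"
proof (rule summable_comparison_test')
  show "summable (\<lambda>k. lam ^ k * (1 - lam))"
    using geometric_majorant by (rule sums_summable)
  show "norm (lam ^ k * (\<phi> (fst ((pull ^^ Suc k) p)) - lam / 2)) \<le> lam ^ k * (1 - lam)" for k
    using height_term_bounds[OF assms, of k] by (simp only: real_norm_def abs_of_nonneg)
qed

lemma height_bounds:
  assumes "p \<in> D"
  shows "height p \<in> {0..1}"
proof -
  have "0 \<le> height p"
    unfolding height_def using summable_height[OF assms] height_term_bounds(1)[OF assms]
    by (rule suminf_nonneg)
  moreover have "height p \<le> (\<Sum>k. lam ^ k * (1 - lam))"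
    unfolding height_def
    using height_term_bounds(2)[OF assms] summable_height[OF assms] sums_summable[OF geometric_majorant]
    by (rule suminf_le)
  ultimately show ?thesis
    using sums_unique[OF geometric_majorant] by simp
qed

text \<open>Splitting off the first term of the series exhibits the second coordinate of
  \<open>F\<close>, so \<open>F\<close> undoes \<open>pull\<close> on the graph of
  \<open>height\<close>.\<close>

lemma height_step:
  assumes "p \<in> D"
  shows "height p = \<phi> (fst (pull p)) + lam * (height (pull p) - 1/2)"
proof -
  let ?f = "\<lambda>k. lam ^ k * (\<phi> (fst ((pull ^^ Suc k) p)) - lam / 2)"
  have "?f (Suc k) = lam * (lam ^ k * (\<phi> (fst ((pull ^^ Suc k) (pull p))) - lam / 2))" for k
    by (simp add: funpow_swap1)
  then have "(\<Sum>k. ?f (Suc k)) = lam * height (pull p)"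
    unfolding height_def
    by (simp only: suminf_mult[OF summable_height[OF pull_maps[OF assms]]])
  moreover have "height p = ?f 0 + (\<Sum>k. ?f (Suc k))"
    unfolding height_def by (subst suminf_split_head[OF summable_height[OF assms]]) simp
  ultimately show ?thesis by (simp add: algebra_simps)
qed

text \<open>The points over the iterates of \<open>pull\<close> form an infinite backward
  \<open>F\<close>-orbit inside \<open>Q\<close>.\<close>

lemma graph_in_attractor:
  assumes "p \<in> D"
  shows "(fst p, height p) \<in> attractor"
proof -
  have "(fst p, height p) \<in> (F ^^ n) ` Q" if "p \<in> D" for n p
    using that
  proof (induction n arbitrary: p)
    case 0
    then show ?case
      using height_bounds[OF 0] by (auto simp: Q_def D_def)
  next
    case (Suc n)
    have D: "pull p \<in> D" using Suc.prems by (rule pull_maps)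
    have "F (fst (pull p), height (pull p)) =
        (T (fst (pull p)), \<phi> (fst (pull p)) + lam * (height (pull p) - 1/2))"
      using D height_bounds[OF D] by (intro F_eq) (auto simp: D_def)
    then have "F (fst (pull p), height (pull p)) = (fst p, height p)"
      using T_fst_pull[OF Suc.prems] height_step[OF Suc.prems] by simp
    then show ?case
      unfolding F_image_Suc using Suc.IH[OF D] by (metis image_eqI)
  qed
  then show ?thesis using assms unfolding attractor_def by blast
qed

text \<open>Different first digits select preimages in different laps, where monotonicity separates
  the values of \<phi> by at least \<open>\<bar>\<phi> c - \<phi> d\<bar>\<close>; the remaining
  terms can close this distance by at most \<open>lam\<close>.\<close>

lemma height_separated:
  assumes "p \<in> D" "q \<in> D" "snd p < 1/2" "1/2 \<le> snd q"
  shows "gap \<le> \<bar>height p - height q\<bar>"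
proof -
  have x: "fst (pull p) \<in> {a..c}"
    using assms(1,3) left_branch(1) by (auto simp: D_def pull_def)
  have y: "fst (pull q) \<in> {d..b}"
    using assms(2,4) right_branch(1) by (auto simp: D_def pull_def)
  have "\<bar>\<phi> c - \<phi> d\<bar> \<le> \<bar>\<phi> (fst (pull p)) - \<phi> (fst (pull q))\<bar>"
    using phi_mono
  proof
    assume m: "mono_on {a..b} \<phi>"
    have "\<phi> (fst (pull p)) \<le> \<phi> c" "\<phi> c \<le> \<phi> d" "\<phi> d \<le> \<phi> (fst (pull q))"
      by (rule monotone_onD[OF m]; use x y ac cd db in simp)+
    then show ?thesis by simp
  next
    assume m: "antimono_on {a..b} \<phi>"
    have "\<phi> (fst (pull p)) \<ge> \<phi> c" "\<phi> c \<ge> \<phi> d" "\<phi> d \<ge> \<phi> (fst (pull q))"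
      by (rule monotone_onD[OF m]; use x y ac cd db in simp)+
    then show ?thesis by simp
  qed
  moreover have "\<bar>lam * (height (pull p) - height (pull q))\<bar> \<le> lam"
    using height_bounds[OF pull_maps[OF assms(1)]] height_bounds[OF pull_maps[OF assms(2)]] lam
    by (auto simp: abs_mult abs_le_iff)
  moreover have "height p - height q =
      (\<phi> (fst (pull p)) - \<phi> (fst (pull q))) + lam * (height (pull p) - height (pull q))"
    by (simp add: height_step[OF assms(1)] height_step[OF assms(2)] algebra_simps)
  ultimately show ?thesis
    unfolding gap_def by linarith
qed

text \<open>Each common leading digit halves \<open>\<bar>t - u\<bar>\<close> and multiplies the
  height difference by \<open>lam\<close>; as \<open>lam powr s = 1 / 2\<close>, both sides scale
  alike. At the first differing digit the heights are \<open>gap\<close> apart and the power is at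
  least 1. The error \<open>(1/2) ^ n\<close> pays for stopping after \<open>n\<close>
  digits.\<close>

lemma height_inverse_hoelder_upto:
  assumes "x \<in> {a..b}" "t \<in> {0..<1}" "u \<in> {0..<1}"
  shows "\<bar>t - u\<bar> \<le> (1/2) ^ n + (\<bar>height (x, t) - height (x, u)\<bar> / gap) powr s"
  using assms
proof (induction n arbitrary: x t u)
  case 0
  have "\<bar>t - u\<bar> \<le> 1"
    using 0(2,3) by (auto simp: abs_le_iff)
  then show ?case
    using powr_ge_zero[of "\<bar>height (x, t) - height (x, u)\<bar> / gap" s] unfolding power_0 by linarith
next
  case (Suc n)
  have in_D: "(x, t) \<in> D" "(x, u) \<in> D"
    using Suc.prems by (auto simp: D_def)
  have half: "0 \<le> ((1::real)/2) ^ Suc n" by simp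
  show ?case
  proof (cases "t < 1/2 \<longleftrightarrow> u < 1/2")
    case False
    have "gap \<le> \<bar>height (x, t) - height (x, u)\<bar>"
    proof (cases "t < 1/2")
      case True
      then show ?thesis using height_separated[OF in_D] False by simp
    next
      case not_less: False
      then show ?thesis
        using height_separated[OF in_D(2,1)] False by (simp add: abs_minus_commute)
    qed
    then have "1 \<le> (\<bar>height (x, t) - height (x, u)\<bar> / gap) powr s"
      using gap_pos s_pos by (intro ge_one_powr_ge_zero) (auto simp: le_divide_eq)
    moreover have "\<bar>t - u\<bar> \<le> 1"
      using Suc.prems(2,3) by (auto simp: abs_le_iff)
    ultimately show ?thesis using half by linarith
  next
    case True
    \<comment> \<open>Equal first digits use the same branch, so both points move to a common
      abscissa \<open>x'\<close> and the induction hypothesis applies.\<close>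
    define x' t' u' where "x' = fst (pull (x, t))" and "t' = snd (pull (x, t))" and "u' = snd (pull (x, u))"
    have eq: "pull (x, t) = (x', t')" "pull (x, u) = (x', u')"
      using True by (auto simp: pull_def x'_def t'_def u'_def)
    have "(x', t') \<in> D" "(x', u') \<in> D"
      using pull_maps[OF in_D(1)] pull_maps[OF in_D(2)] by (simp_all add: eq)
    then have IH: "\<bar>t' - u'\<bar> \<le> (1/2) ^ n + (\<bar>height (x', t') - height (x', u')\<bar> / gap) powr s"
      by (intro Suc.IH) (auto simp: D_def)
    have "\<bar>t - u\<bar> = 1/2 * \<bar>t' - u'\<bar>"
      using True by (auto simp: pull_def t'_def u'_def abs_if)
    moreover have "\<bar>height (x, t) - height (x, u)\<bar> / gap = lam * (\<bar>height (x', t') - height (x', u')\<bar> / gap)"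
      using height_step[OF in_D(1)] height_step[OF in_D(2)] lam
      by (simp add: eq abs_mult flip: right_diff_distrib)
    then have "(\<bar>height (x, t) - height (x, u)\<bar> / gap) powr s =
        1/2 * (\<bar>height (x', t') - height (x', u')\<bar> / gap) powr s"
      using lam gap_pos by (simp only: powr_mult lam_powr_s)
    ultimately show ?thesis
      using IH by (simp add: algebra_simps)
  qed
qed

lemma height_inverse_hoelder:
  assumes "x \<in> {a..b}" "t \<in> {0..<1}" "u \<in> {0..<1}"
  shows "\<bar>t - u\<bar> \<le> (\<bar>height (x, t) - height (x, u)\<bar> / gap) powr s"
proof (rule LIMSEQ_le_const)
  show "(\<lambda>n. (1/2) ^ n + (\<bar>height (x, t) - height (x, u)\<bar> / gap) powr s) \<longlonglongrightarrow>
      (\<bar>height (x, t) - height (x, u)\<bar> / gap) powr s"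
    using tendsto_add[OF LIMSEQ_power_zero[of "1/2::real"] tendsto_const] by simp
  show "\<exists>N. \<forall>n\<ge>N. \<bar>t - u\<bar> \<le> (1/2) ^ n + (\<bar>height (x, t) - height (x, u)\<bar> / gap) powr s"
    using height_inverse_hoelder_upto[OF assms] by blast
qed

section \<open>Lower bound: integrating the fibre estimate over the abscissas\<close>

text \<open>The pull-pull of a set \<open>U\<close> to \<open>D\<close> lies over an interval of length \<open>2 diameter U\<close>, with fibres
  contained in intervals of length \<open>2 (diameter U / gap)\<^sup>s\<close>; no measurability of \<open>U\<close> is needed.\<close>

lemma fibre_cover_bound:
  assumes cov: "attractor \<subseteq> (\<Union>i. U i)" and bd: "\<And>i. bounded (U i)" and x: "x \<in> {a..b}"
    and z: "\<And>i. U i \<noteq> {} \<Longrightarrow> z i \<in> U i"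
  shows "1 \<le> (\<Sum>i. ennreal (2 * (diameter (U i) / gap) powr s) *
    indicator (cball (fst (z i)) (diameter (U i))) x)"
proof -
  define A where "A i = {t \<in> {0..<1}. (x, height (x, t)) \<in> U i}" for i
  define r where "r i = (diameter (U i) / gap) powr s" for i
  \<comment> \<open>A closed interval around a chosen point of \<open>A i\<close> is a measurable
    substitute for \<open>A i\<close>.\<close>
  define B where "B i = (if A i = {} then {} else cball (SOME t. t \<in> A i) (r i))" for i
  have A_near: "\<bar>t - u\<bar> \<le> r i" if "t \<in> A i" "u \<in> A i" for t u i
  proof -
    have "dist (x, height (x, t)) (x, height (x, u)) \<le> diameter (U i)"
      using that bd by (intro diameter_bounded_bound) (auto simp: A_def)
    then have "\<bar>height (x, t) - height (x, u)\<bar> \<le> diameter (U i)"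
      by (simp add: dist_Pair_Pair dist_real_def)
    then have "(\<bar>height (x, t) - height (x, u)\<bar> / gap) powr s \<le> r i"
      unfolding r_def using gap_pos s_pos by (intro powr_mono2 divide_right_mono) auto
    moreover have "\<bar>t - u\<bar> \<le> (\<bar>height (x, t) - height (x, u)\<bar> / gap) powr s"
      using that x by (intro height_inverse_hoelder) (auto simp: A_def)
    ultimately show ?thesis by linarith
  qed
  have AB: "A i \<subseteq> B i" for i
  proof
    fix t assume t: "t \<in> A i"
    then have "(SOME t. t \<in> A i) \<in> A i" by (rule someI)
    then show "t \<in> B i" using A_near[OF _ t] t by (auto simp: B_def dist_real_def)
  qed
  have "{0..<1} \<subseteq> (\<Union>i. B i)"
  proof
    fix t :: real assume t: "t \<in> {0..<1}"
    then have "(x, height (x, t)) \<in> attractor"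
      using graph_in_attractor[of "(x, t)"] x by (simp add: D_def)
    then obtain i where "(x, height (x, t)) \<in> U i" using cov by blast
    then have "t \<in> A i" using t by (simp add: A_def)
    then show "t \<in> (\<Union>i. B i)" using AB by blast
  qed
  moreover have B_sets: "B i \<in> sets lborel" for i
    by (simp add: B_def)
  ultimately have "emeasure lborel {0..<1::real} \<le> emeasure lborel (\<Union>i. B i)"
    by (intro emeasure_mono) auto
  also have "\<dots> \<le> (\<Sum>i. emeasure lborel (B i))"
    using B_sets by (intro emeasure_subadditive_countably) auto
  also have "\<dots> \<le> (\<Sum>i. ennreal (2 * r i) * indicator (cball (fst (z i)) (diameter (U i))) x)"
  proof (intro suminf_le)
    fix i
    show "emeasure lborel (B i) \<le> ennreal (2 * r i) * indicator (cball (fst (z i)) (diameter (U i))) x"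
    \<comment> \<open>If the fibre over \<open>x\<close> meets \<open>U i\<close>, then
      \<open>x\<close> lies within one diameter of the reference abscissa and the indicator is 1;
      otherwise \<open>B i\<close> is empty.\<close>
    proof (cases "A i = {}")
      case False
      then obtain t where "(x, height (x, t)) \<in> U i" by (auto simp: A_def)
      moreover from this have "z i \<in> U i" using z by blast
      ultimately have "dist (z i) (x, height (x, t)) \<le> diameter (U i)"
        using bd by (intro diameter_bounded_bound)
      then have "x \<in> cball (fst (z i)) (diameter (U i))"
        using dist_fst_le[of "z i" "(x, height (x, t))"] by simp
      moreover have "emeasure lborel (B i) = ennreal (2 * r i)"
      proof -
        have "0 \<le> r i" by (simp add: r_def)
        then show ?thesis
          using False by (simp add: B_def cball_eq_atLeastAtMost)
      qed
      ultimately show ?thesis by simp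
    qed (simp add: B_def)
  qed auto
  finally show ?thesis by (simp add: r_def)
qed

text \<open>A mass distribution argument. Integrating the fibre bound over \<open>{a..b}\<close>
  charges a set of diameter \<open>r\<close> with \<open>2 * (r / gap) powr s * (2 * r)\<close>,
  that is, \<open>4 / gap powr s * r powr (1 + s)\<close>; these charges must add up to at least
  \<open>b - a\<close>.\<close>

lemma hausdorff_sum_lower_bound:
  assumes U: "U \<in> delta_covers 1 attractor" and t: "0 \<le> t" "t \<le> 1 + s"
  shows "ennreal ((b - a) / 4 * gap powr s) \<le> (\<Sum>i. diam_powr (U i) t)"
proof -
  have cov: "attractor \<subseteq> (\<Union>i. U i)" and bd: "\<And>i. bounded (U i)" and le1: "\<And>i. diameter (U i) \<le> 1"
    using U by (auto simp: delta_covers_def)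
  \<comment> \<open>For empty \<open>U i\<close> the centre is arbitrary, but its coefficient
    vanishes because the diameter is 0.\<close>
  define z where "z i = (SOME p. p \<in> U i)" for i
  have z: "z i \<in> U i" if "U i \<noteq> {}" for i
    using that unfolding z_def by (simp add: some_in_eq)
  define \<delta> where "\<delta> i = diameter (U i)" for i
  have \<delta>: "0 \<le> \<delta> i" for i using bd by (simp add: \<delta>_def diameter_ge_0)
  have fib: "indicator {a..b} x \<le> (\<Sum>i. ennreal (2 * (\<delta> i / gap) powr s) * indicator (cball (fst (z i)) (\<delta> i)) x)"
    (is "_ \<le> ?S x") for x
    using fibre_cover_bound[OF cov bd _ z, of x] by (cases "x \<in> {a..b}") (simp_all add: \<delta>_def)
  have "ennreal (b - a) = (\<integral>\<^sup>+x. indicator {a..b} x \<partial>lborel)"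
    using ac cd db by simp
  also have "\<dots> \<le> (\<integral>\<^sup>+x. ?S x \<partial>lborel)"
    by (intro nn_integral_mono fib)
  also have "\<dots> = (\<Sum>i. \<integral>\<^sup>+x. ennreal (2 * (\<delta> i / gap) powr s) * indicator (cball (fst (z i)) (\<delta> i)) x \<partial>lborel)"
    by (intro nn_integral_suminf borel_measurable_times_ennreal borel_measurable_const
        borel_measurable_indicator) simp
  also have "\<dots> = (\<Sum>i. ennreal (4 / gap powr s) * ennreal (\<delta> i powr (1 + s)))"
  proof (rule suminf_cong)
    fix i
    have "(\<integral>\<^sup>+x. ennreal (2 * (\<delta> i / gap) powr s) * indicator (cball (fst (z i)) (\<delta> i)) x \<partial>lborel) =
        ennreal (2 * (\<delta> i / gap) powr s) * ennreal (2 * \<delta> i)"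
      using \<delta>[of i] by (simp add: nn_integral_cmult_indicator cball_eq_atLeastAtMost)
    also have "\<dots> = ennreal (2 * (\<delta> i / gap) powr s * (2 * \<delta> i))"
      using \<delta>[of i] by (intro ennreal_mult[symmetric]) auto
    also have "2 * (\<delta> i / gap) powr s * (2 * \<delta> i) = 4 / gap powr s * \<delta> i powr (1 + s)"
      using \<delta>[of i] gap_pos by (cases "\<delta> i = 0") (simp_all add: powr_add powr_divide)
    also have "ennreal \<dots> = ennreal (4 / gap powr s) * ennreal (\<delta> i powr (1 + s))"
      by (intro ennreal_mult) auto
    finally show "(\<integral>\<^sup>+x. ennreal (2 * (\<delta> i / gap) powr s) * indicator (cball (fst (z i)) (\<delta> i)) x \<partial>lborel) =
        ennreal (4 / gap powr s) * ennreal (\<delta> i powr (1 + s))" .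
  qed
  also have "\<dots> = ennreal (4 / gap powr s) * (\<Sum>i. ennreal (\<delta> i powr (1 + s)))"
    by simp
  \<comment> \<open>Covers at scale 1 have diameters at most 1, so the exponent \<open>1 + s\<close>
    may be lowered to \<open>t\<close>.\<close>
  also have "\<dots> \<le> ennreal (4 / gap powr s) * (\<Sum>i. diam_powr (U i) t)"
    using t s_pos bd le1 unfolding \<delta>_def
    by (intro mult_left_mono suminf_le diam_powr_ge) auto
  finally have "ennreal (gap powr s / 4) * ennreal (b - a) \<le>
      ennreal (gap powr s / 4) * (ennreal (4 / gap powr s) * (\<Sum>i. diam_powr (U i) t))"
    by (rule mult_left_mono) simp
  also have "\<dots> = ennreal (gap powr s / 4 * (4 / gap powr s)) * (\<Sum>i. diam_powr (U i) t)"
    by (subst ennreal_mult) (auto simp: mult.assoc)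
  also have "gap powr s / 4 * (4 / gap powr s) = 1"
    using gap_pos by simp
  also have "ennreal (gap powr s / 4) * ennreal (b - a) = ennreal ((b - a) / 4 * gap powr s)"
    using ac cd db by (simp add: mult.commute flip: ennreal_mult)
  finally show ?thesis by simp
qed

section \<open>The dimension of the attractor\<close>

lemma hausdorff_measure_attractor_neq_0:
  assumes "0 \<le> t" "t \<le> 1 + s"
  shows "hausdorff_measure t attractor \<noteq> 0"
proof
  assume "hausdorff_measure t attractor = 0"
  then have "hausdorff_premeasure t 1 attractor = 0"
    by (simp add: hausdorff_measure_eq_0_iff)
  moreover have "0 < (b - a) / 4 * gap powr s"
    using ac cd db gap_pos by (intro mult_pos_pos) auto
  then have "0 < ennreal ((b - a) / 4 * gap powr s)"
    by (simp only: ennreal_less_zero_iff)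
  ultimately obtain U where "U \<in> delta_covers 1 attractor"
      "(\<Sum>i. diam_powr (U i) t) < ennreal ((b - a) / 4 * gap powr s)"
    by (rule hausdorff_premeasure_eq_0D)
  then show False
    using hausdorff_sum_lower_bound[OF _ assms, of U] by simp
qed

lemma hausdorff_dim_attractor: "hausdorff_dim attractor = ereal (1 + s)"
  unfolding hausdorff_dim_def
proof (rule antisym)
  let ?Z = "{ereal t |t. 0 \<le> t \<and> hausdorff_measure t attractor = 0}"
  show "Inf ?Z \<le> ereal (1 + s)"
  proof (rule ereal_le_epsilon2)
    fix e :: real assume "0 < e"
    then have "hausdorff_measure (1 + s + e) attractor = 0" "0 \<le> 1 + s + e"
      using s_pos by (auto intro: hausdorff_measure_attractor_eq_0)
    then have "Inf ?Z \<le> ereal (1 + s + e)"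
      by (intro Inf_lower) blast
    then show "Inf ?Z \<le> ereal (1 + s) + ereal e" by simp
  qed
  show "ereal (1 + s) \<le> Inf ?Z"
  proof (rule Inf_greatest)
    fix y assume "y \<in> ?Z"
    then obtain t where t: "y = ereal t" "0 \<le> t" "hausdorff_measure t attractor = 0" by blast
    then have "\<not> t \<le> 1 + s"
      using hausdorff_measure_attractor_neq_0 by blast
    then show "ereal (1 + s) \<le> y" using t(1) by simp
  qed
qed

end

theorem theorem3p1:
  fixes a b c d lam :: real
    and T \<phi> :: "real \<Rightarrow> real"
    and F :: "real \<times> real \<Rightarrow> real \<times> real"
    and Q \<Lambda> :: "(real \<times> real) set"
  assumes "a < c" and "c < d" and "d < b"
    and "T ` {a..b} \<subseteq> {a..b}"
    and "mono_on {a..c} T \<or> antimono_on {a..c} T"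
    and "mono_on {d..b} T \<or> antimono_on {d..b} T"
    and "T ` {a..c} = {a..b}" and "T ` {d..b} = {a..b}"
    and "T ` {c<..<d} \<subseteq> {a, b}"
    and "0 < lam" and "lam < 1 / 2"
    and "\<phi> ` {a..b} \<subseteq> {1 / 2..1 - lam / 2}"
    and "strict_mono_on {a..b} \<phi> \<or> strict_antimono_on {a..b} \<phi>"
    and "\<bar>\<phi> c - \<phi> d\<bar> > lam"
    and "Q = {a..b} \<times> {0..1}"
    and "\<And>x y. (x, y) \<in> Q \<Longrightarrow> F (x, y) = (T x, \<phi> x + lam * (y - 1 / 2))"
    and "\<Lambda> = (\<Inter>n. (F ^^ n) ` Q)"
  shows "hausdorff_dim \<Lambda> = ereal (1 + ln 2 / (- ln lam))"
proof -
  have phi_mono: "mono_on {a..b} \<phi> \<or> antimono_on {a..b} \<phi>"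
    using assms(13) strict_mono_on_imp_mono_on by (auto simp: monotone_on_def order_le_less)
  interpret B: skew_baker_map a b c d lam T \<phi> F
  proof
    show "F (x, y) = (T x, \<phi> x + lam * (y - 1 / 2))" if "x \<in> {a..b}" "y \<in> {0..1}" for x y
      using assms(15,16) that by blast
  qed (fact assms phi_mono)+
  have "\<Lambda> = B.attractor"
    by (simp only: assms(17) B.attractor_def B.Q_def assms(15))
  then show ?thesis
    by (simp only: B.hausdorff_dim_attractor B.s_def)
qed

end
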